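(* Let $n\ge1$, let $R,H\subseteq\{0,1,\dots,n-1\}$, $S_1=\{a^{2r},\ a^{2r}b,\ a^{-2r}b^2\mid r\in R\}$ and $S_2=\{a^{2h+1},\ a^{2h+1}b,\ a^{2h+1}b^2\mid h\in H\}$, such that $S=S_1\cup S_2\subseteq U_{6n}$ satisfies $1\notin S=S^{-1}$. Put $S_R=\{a^{2r}\mid r\in R\}$ and $S_H=\{a^{2h+1}\mid h\in H\}$. Then $\mathrm{Cay}(U_{6n},S)$ is integral if and only if both of the following hold: (1) $S_R\cup S_H\in B(\langle a\rangle)$; (2) $2\psi_k(S_2^2)$ is a perfect square (the square of an integer) for every $0\le k\le n-1$.
   Context: For an integer $n\ge1$, $U_{6n}=\langle a,b\mid a^{2n}=b^3=1,\ a^{-1}ba=b^{-1}\rangle$, a group of order $6n$ whose elements are uniquely $a^ib^\epsilon$ with $0\le i\le 2n-1$, $\epsilon\in\{0,1,2\}$; $\langle a\rangle$ is cyclic of order $2n$. Let $\omega=\exp(\pi\imath/n)$. The degree-two irreducible characters $\psi_k$ ($0\le k\le n-1$) of $U_{6n}$ are given by $\psi_k(a^{2r})=2\omega^{2kr}$, $\psi_k(a^{2r}b)=\psi_k(a^{2r}b^2)=-\omega^{2kr}$, $\psi_k(a^{2r+1}b^\epsilon)=0$. For a character $\chi$ and a subset $A$, $\chi(A^2)=\sum_{x_1,x_2\in A}\chi(x_1x_2)$ over all ordered pairs. For a finite group $G$, the Boolean algebra $B(G)$ is the collection of subsets of $G$ obtainable from the subgroups of $G$ by finitely many unions, intersections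 and complements (in $G$). For a group $G$ and $S\subseteq G$ with $1\notin S=S^{-1}$, the Cayley graph $\mathrm{Cay}(G,S)$ has vertex set $G$ and edges $\{g,sg\}$ for $g\in G,s\in S$. A graph is integral if all eigenvalues of its adjacency matrix are integers. *)

theory Defs
  imports "HOL-Algebra.Group" "Jordan_Normal_Form.Char_Poly"
begin

text \<open>The group U_{6n} realised concretely: the element a^i b^e (0 \<le> i < 2n, 0 \<le> e < 3)
  is the pair (i, e).  From a^{-1} b a = b^{-1} we get b^e a^j = a^j b^{(-1)^j e}, hence
  (a^i b^e)(a^j b^f) = a^{i+j} b^{(-1)^j e + f}.\<close>

definition umul :: "nat \<Rightarrow> nat \<times> nat \<Rightarrow> nat \<times> nat \<Rightarrow> nat \<times> nat" where
  "umul n x y = ((fst x + fst y) mod (2*n),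
                 ((if even (fst y) then snd x else 2 * snd x) + snd y) mod 3)"

definition U :: "nat \<Rightarrow> (nat \<times> nat) monoid" where
  "U n = \<lparr>carrier = {0..<2*n} \<times> {0..<3}, mult = umul n, one = (0, 0)\<rparr>"

definition apow :: "nat \<Rightarrow> int \<Rightarrow> nat \<Rightarrow> nat \<times> nat" where
  "apow n k e = (nat (k mod int (2*n)), e mod 3)"

definition cycA :: "nat \<Rightarrow> (nat \<times> nat) monoid" where
  "cycA n = \<lparr>carrier = {0..<2*n} \<times> {0}, mult = umul n, one = (0, 0)\<rparr>"

inductive_set boolalg :: "('a, 'b) monoid_scheme \<Rightarrow> 'a set set" for G where
  sub: "subgroup H G \<Longrightarrow> H \<in> boolalg G"
| un: "X \<in> boolalg G \<Longrightarrow> Y \<in> boolalg G \<Longrightarrow> X \<union> Y \<in> boolalg G"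
| int: "X \<in> boolalg G \<Longrightarrow> Y \<in> boolalg G \<Longrightarrow> X \<inter> Y \<in> boolalg G"
| compl: "X \<in> boolalg G \<Longrightarrow> carrier G - X \<in> boolalg G"

text \<open>omega = exp(pi i / n) and the degree-two characters psi_k of U_{6n}:
  psi_k(a^{2r}) = 2 omega^{2kr}, psi_k(a^{2r} b) = psi_k(a^{2r} b^2) = - omega^{2kr},
  psi_k(a^{2r+1} b^e) = 0.\<close>
definition omega :: "nat \<Rightarrow> complex" where
  "omega n = exp (complex_of_real pi * \<i> / of_nat n)"

definition psi :: "nat \<Rightarrow> nat \<Rightarrow> nat \<times> nat \<Rightarrow> complex" where
  "psi n k x = (if even (fst x)
                then (if snd x = 0 then 2 * omega n ^ (k * fst x) else - (omega n ^ (k * fst x)))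
                else 0)"

definition charsq :: "nat \<Rightarrow> (nat \<times> nat \<Rightarrow> complex) \<Rightarrow> (nat \<times> nat) set \<Rightarrow> complex" where
  "charsq n chi A = (\<Sum>x1\<in>A. \<Sum>x2\<in>A. chi (umul n x1 x2))"

definition uelt :: "nat \<Rightarrow> nat \<times> nat" where
  "uelt m = (m div 3, m mod 3)"

definition cay_adj :: "nat \<Rightarrow> (nat \<times> nat) set \<Rightarrow> complex mat" where
  "cay_adj n S = mat (6*n) (6*n)
     (\<lambda>(i, j). if (\<exists>s\<in>S. uelt j = umul n s (uelt i) \<or> uelt i = umul n s (uelt j)) then 1 else 0)"

definition integral_graph :: "complex mat \<Rightarrow> bool" where
  "integral_graph A \<longleftrightarrow> (\<forall>ev. eigenvalue A ev \<longrightarrow> ev \<in> \<int>)"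

end

theory Submission
  imports Defs "HOL-Number_Theory.Residues"
begin

text \<open>Since S is closed under inversion, so is the set of even exponents R, hence S is the product
  of \<open>T = S\<^sub>R \<union> S\<^sub>H\<close> with \<open>\<langle>b\<rangle>\<close>. The sum of \<open>\<langle>b\<rangle>\<close> vanishes in every degree-two representation, so
  condition (2) always holds (the value is 0), and the eigenvalues of the graph are 0 and three
  times the character sums of T over the cyclic group of order m = 2n.

  These sums are integers iff T lies in the Boolean algebra. If it does, its indicator is an integral
  combination of indicators of subgroups, whose character sums are integers. Conversely, for a
  prime q > 2m the sums at k and qk are congruent modulo q by Frobenius and Fermat, and
  both are at most m in absolute value, so they are equal. Every class coprime to a given modulus contains
  a product of such primes, so by Fourier inversion T is a union of classes of elements generating
  the same subgroup.\<close>

section \<open>Roots of unity with integer exponents and their orthogonality\<close>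

definition zeta :: "nat \<Rightarrow> int \<Rightarrow> complex" where
  "zeta m l = cis (2 * pi * of_int l / of_nat m)"

lemma zeta_0 [simp]: "zeta m 0 = 1"
  by (simp add: zeta_def)

lemma zeta_add: "zeta m (k + l) = zeta m k * zeta m l"
  by (simp add: zeta_def cis_mult add_divide_distrib distrib_left)

lemma zeta_power: "zeta m l ^ q = zeta m (int q * l)"
  by (simp add: zeta_def DeMoivre mult_ac)

lemma norm_zeta [simp]: "norm (zeta m l) = 1"
  by (simp add: zeta_def)

lemma zeta_eq_1_iff:
  assumes "m > 0"
  shows "zeta m l = 1 \<longleftrightarrow> int m dvd l"
proof
  assume "zeta m l = 1"
  then have "cos (2 * pi * of_int l / of_nat m) = 1"
    by (simp add: zeta_def complex_eq_iff)
  then obtain c :: int where "2 * pi * of_int l / of_nat m = of_int c * 2 * pi"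
    unfolding cos_one_2pi_int by blast
  then have "real_of_int l = of_int (c * int m)"
    using assms by (simp add: field_simps)
  then have "l = c * int m" by (simp only: of_int_eq_iff)
  then show "int m dvd l" by simp
next
  assume "int m dvd l"
  then obtain c where "l = int m * c" ..
  then show "zeta m l = 1"
    using assms cis_multiple_2pi[of "of_int c"] by (simp add: zeta_def mult_ac)
qed

lemma zeta_cong:
  assumes "m > 0" "[k = l] (mod int m)"
  shows "zeta m k = zeta m l"
proof -
  have "int m dvd k - l" using assms(2) by (simp add: cong_iff_dvd_diff)
  then show ?thesis
    using zeta_add[of m "k - l" l] zeta_eq_1_iff[OF assms(1), of "k - l"] by simp
qed

text \<open>A geometric sum whose ratio is an m-th root of unity; this is the orthogonality behind
  every Fourier argument below.\<close>

lemma sum_zeta: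
  assumes "m > 0"
  shows "(\<Sum>x<m. zeta m (k * int x)) = (if int m dvd k then of_nat m else 0)"
proof -
  have pow: "zeta m (k * int x) = zeta m k ^ x" for x
    by (simp add: zeta_power mult_ac)
  show ?thesis
  proof (cases "int m dvd k")
    case True
    then have "zeta m k = 1" using zeta_eq_1_iff[OF assms] by blast
    with True show ?thesis by (simp add: pow)
  next
    case False
    moreover have "zeta m k ^ m = 1"
      using zeta_eq_1_iff[OF assms] by (simp add: zeta_power)
    ultimately show ?thesis
      using zeta_eq_1_iff[OF assms] by (simp add: pow sum_gp_strict)
  qed
qed

section \<open>Elements of \<open>\<int>[\<zeta>]\<close>\<close>

text \<open>Multiplication by x maps the lattice spanned by the m-th roots of unity into itself; this
  is membership in \<open>\<int>[\<zeta>]\<close>, phrased so that integrality can be read off from a matrix.\<close>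
definition cyc_int :: "nat \<Rightarrow> complex \<Rightarrow> bool" where
  "cyc_int m x \<longleftrightarrow> (\<exists>a :: nat \<Rightarrow> nat \<Rightarrow> int. \<forall>i<m. x * zeta m (int i) = (\<Sum>k<m. of_int (a i k) * zeta m (int k)))"

lemma cyc_int_of_int: "cyc_int m (of_int c)"
  unfolding cyc_int_def
  by (rule exI[of _ "\<lambda>i k. if k = i then c else 0"]) (auto simp: if_distrib if_distribR cong: if_cong)

lemma cyc_int_of_nat: "cyc_int m (of_nat c)"
  using cyc_int_of_int[of m "int c"] by simp

lemma cyc_int_add:
  assumes "cyc_int m x" "cyc_int m y"
  shows "cyc_int m (x + y)"
proof -
  obtain a b :: "nat \<Rightarrow> nat \<Rightarrow> int"
    where "\<forall>i<m. x * zeta m (int i) = (\<Sum>k<m. of_int (a i k) * zeta m (int k))"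
      and "\<forall>i<m. y * zeta m (int i) = (\<Sum>k<m. of_int (b i k) * zeta m (int k))"
    using assms unfolding cyc_int_def by blast
  then show ?thesis
    unfolding cyc_int_def
    by (intro exI[of _ "\<lambda>i k. a i k + b i k"]) (auto simp: distrib_right sum.distrib)
qed

text \<open>Applying the two lattice maps in succession amounts to multiplying their integer
  matrices, which gives the witness for the product.\<close>

lemma cyc_int_mult:
  assumes "cyc_int m x" "cyc_int m y"
  shows "cyc_int m (x * y)"
proof -
  obtain a b :: "nat \<Rightarrow> nat \<Rightarrow> int"
    where a: "\<And>i. i < m \<Longrightarrow> x * zeta m (int i) = (\<Sum>k<m. of_int (a i k) * zeta m (int k))"
      and b: "\<And>i. i < m \<Longrightarrow> y * zeta m (int i) = (\<Sum>k<m. of_int (b i k) * zeta m (int k))"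
    using assms unfolding cyc_int_def by blast
  have "x * y * zeta m (int i) = (\<Sum>k<m. of_int (\<Sum>j<m. a i j * b j k) * zeta m (int k))"
    if "i < m" for i
  proof -
    have "x * y * zeta m (int i) = (\<Sum>j<m. of_int (a i j) * (y * zeta m (int j)))"
      using arg_cong[OF a[OF that], of "\<lambda>z. y * z"] by (simp add: sum_distrib_left mult_ac)
    also have "\<dots> = (\<Sum>j<m. \<Sum>k<m. of_int (a i j * b j k) * zeta m (int k))"
      by (intro sum.cong refl) (simp add: b sum_distrib_left mult_ac)
    also have "\<dots> = (\<Sum>k<m. of_int (\<Sum>j<m. a i j * b j k) * zeta m (int k))"
      by (subst sum.swap) (simp add: sum_distrib_right)
    finally show ?thesis .
  qed
  then show ?thesis unfolding cyc_int_def by (intro exI allI impI)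
qed

lemma cyc_int_power: "cyc_int m x \<Longrightarrow> cyc_int m (x ^ j)"
  using cyc_int_of_int[of m 1] by (induction j) (auto intro: cyc_int_mult)

lemma cyc_int_sum: "(\<And>t. t \<in> T \<Longrightarrow> cyc_int m (f t)) \<Longrightarrow> cyc_int m (\<Sum>t\<in>T. f t)"
  using cyc_int_of_int[of m 0]
  by (induction T rule: infinite_finite_induct) (auto intro: cyc_int_add)

text \<open>Multiplication by a root of unity permutes the spanning roots cyclically, so a
  permutation matrix is the witness.\<close>

lemma cyc_int_zeta: "cyc_int m (zeta m l)"
  unfolding cyc_int_def
proof (rule exI[of _ "\<lambda>i k. if k = nat ((int i + l) mod int m) then 1 else 0"], intro allI impI)
  fix i assume "i < m"
  then have "nat ((int i + l) mod int m) < m" by (simp add: nat_less_iff)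
  then have "(\<Sum>k<m. of_int (if k = nat ((int i + l) mod int m) then 1 else 0) * zeta m (int k))
      = zeta m ((int i + l) mod int m)"
    using \<open>i < m\<close> by (simp add: if_distrib if_distribR cong: if_cong)
  also have "\<dots> = zeta m l * zeta m (int i)"
    using \<open>i < m\<close> zeta_cong[of m "(int i + l) mod int m" "int i + l"]
    by (simp add: zeta_add mult.commute)
  finally show "zeta m l * zeta m (int i) =
      (\<Sum>k<m. of_int (if k = nat ((int i + l) mod int m) then 1 else 0) * zeta m (int k))" ..
qed

text \<open>The matrix witnessing \<^const>\<open>cyc_int\<close> has eigenvalue x, hence x is a root of its
  characteristic polynomial, which is monic with integer coefficients.\<close>
lemma cyc_int_algebraic_int:
  assumes "m > 0" "cyc_int m x"
  shows "algebraic_int x"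
proof -
  obtain a :: "nat \<Rightarrow> nat \<Rightarrow> int"
    where a: "\<And>i. i < m \<Longrightarrow> x * zeta m (int i) = (\<Sum>k<m. of_int (a i k) * zeta m (int k))"
    using assms unfolding cyc_int_def by blast
  define A where "A = mat m m (\<lambda>(i, k). a i k)"
  define B where "B = map_mat (of_int :: int \<Rightarrow> complex) A"
  define v where "v = vec m (\<lambda>i. zeta m (int i))"
  have A: "A \<in> carrier_mat m m" and B: "B \<in> carrier_mat m m" by (auto simp: A_def B_def)
  have "B *\<^sub>v v = x \<cdot>\<^sub>v v"
    by (rule eq_vecI) (auto simp: A_def B_def v_def scalar_prod_def a atLeast0LessThan)
  moreover have "v $ 0 \<noteq> (0\<^sub>v m :: complex vec) $ 0" using assms(1) by (simp add: v_def)
  then have "v \<noteq> 0\<^sub>v m" by metis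
  ultimately have "eigenvalue B x"
    unfolding eigenvalue_def eigenvector_def using B by (intro exI[of _ v]) (auto simp: v_def)
  then have "poly (char_poly B) x = 0"
    using eigenvalue_root_char_poly[OF B] by simp
  moreover have "char_poly B = map_poly of_int (char_poly A)"
    unfolding B_def by (rule of_int_hom.char_poly_hom[OF A])
  ultimately show ?thesis
    unfolding algebraic_int_altdef_ipoly
    using degree_monic_char_poly[OF A] by metis
qed

text \<open>Turns a divisibility in the cyclotomic ring into one between integers: a quotient that
  is rational and lies in the ring is an integer.\<close>

lemma cyc_int_rational:
  assumes "m > 0" "cyc_int m x" "x \<in> \<rat>"
  shows "x \<in> \<int>"
  using rational_algebraic_int_is_int cyc_int_algebraic_int assms by blast

section \<open>Frobenius and Fermat congruences modulo a prime\<close>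

text \<open>The inner binomial coefficients are divisible by the prime \<open>q\<close>. The
  congruence is stated with an explicit cofactor \<open>z\<close>, so no quotient ring has to be
  formed.\<close>

lemma cyc_int_frobenius_add:
  assumes "prime q" "cyc_int m x" "cyc_int m y"
  shows "\<exists>z. cyc_int m z \<and> (x + y) ^ q = x ^ q + y ^ q + of_nat q * z"
proof -
  define z where "z = (\<Sum>k\<in>{0<..<q}. of_nat ((q choose k) div q) * x ^ k * y ^ (q - k))"
  have "q > 0" using assms(1) prime_gt_0_nat by blast
  then have eq: "{..q} = insert 0 (insert q {0<..<q})" by auto
  have summand: "of_nat q * (of_nat ((q choose k) div q) * x ^ k * y ^ (q - k))
      = of_nat (q choose k) * x ^ k * y ^ (q - k)" if "k \<in> {0<..<q}" for k
  proof -
    have "q dvd (q choose k)" using dvd_choose_prime[of k q] that assms(1) by auto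
    then have "q * ((q choose k) div q) = q choose k" by simp
    then show ?thesis by (metis mult.assoc of_nat_mult)
  qed
  have "(x + y) ^ q = x ^ q + y ^ q + (\<Sum>k\<in>{0<..<q}. of_nat (q choose k) * x ^ k * y ^ (q - k))"
    using \<open>q > 0\<close> by (simp add: binomial_ring eq)
  also have "(\<Sum>k\<in>{0<..<q}. of_nat (q choose k) * x ^ k * y ^ (q - k)) = of_nat q * z"
    unfolding z_def sum_distrib_left by (intro sum.cong refl) (simp only: summand)
  finally have "(x + y) ^ q = x ^ q + y ^ q + of_nat q * z" .
  moreover have "cyc_int m z" unfolding z_def
    by (intro cyc_int_sum cyc_int_mult cyc_int_power cyc_int_of_nat assms)
  ultimately show ?thesis by blast
qed

lemma cyc_int_frobenius_sum:
  assumes "prime q" "\<And>t. t \<in> T \<Longrightarrow> cyc_int m (f t)"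
  shows "\<exists>z. cyc_int m z \<and> (\<Sum>t\<in>T. f t) ^ q = (\<Sum>t\<in>T. f t ^ q) + of_nat q * z"
  using assms(2)
proof (induction T rule: infinite_finite_induct)
  case (insert t T)
  obtain z where z: "cyc_int m z" "(\<Sum>t\<in>T. f t) ^ q = (\<Sum>t\<in>T. f t ^ q) + of_nat q * z"
    using insert by auto
  obtain w where w: "cyc_int m w"
      "(f t + (\<Sum>t\<in>T. f t)) ^ q = f t ^ q + (\<Sum>t\<in>T. f t) ^ q + of_nat q * w"
    using cyc_int_frobenius_add[OF assms(1), of m "f t" "\<Sum>t\<in>T. f t"] insert.prems cyc_int_sum[of T m f]
    by auto
  have "(\<Sum>t\<in>insert t T. f t) ^ q = (\<Sum>t\<in>insert t T. f t ^ q) + of_nat q * (z + w)"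
    using insert.hyps w(2) z(2) by (simp add: algebra_simps)
  then show ?case using cyc_int_add[OF z(1) w(1)] by blast
qed (use assms(1) prime_gt_0_nat cyc_int_of_int[of m 0] in \<open>force simp: zero_power\<close>)+

text \<open>Covers negative numbers and multiples of \<open>q\<close> by passing to the natural
  residue \<open>b\<close>.\<close>

lemma fermat_int:
  fixes a :: int
  assumes "prime q"
  shows "int q dvd a ^ q - a"
proof -
  define b where "b = nat (a mod int q)"
  have q: "q > 0" using assms prime_gt_0_nat by blast
  have b: "[int b = a] (mod int q)" using q by (simp add: b_def cong_def)
  have "[b ^ q = b] (mod q)"
  proof (cases "q dvd b")
    case True
    then have "q dvd b ^ q" using q by (metis dvd_power dvd_trans)
    then show ?thesis using True by (simp add: cong_def mod_eq_0_iff_dvd)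
  next
    case False
    then have "[b ^ (q - 1) * b = 1 * b] (mod q)"
      using fermat_theorem[OF assms] by (intro cong_mult) auto
    then show ?thesis using power_minus_mult[OF q, of b] by simp
  qed
  then have "[int b ^ q = int b] (mod int q)" by (metis cong_int_iff of_nat_power)
  then have "[a ^ q = a] (mod int q)"
    using b cong_pow[OF b, of q] by (meson cong_sym cong_trans)
  then show ?thesis by (simp add: cong_iff_dvd_diff)
qed

section \<open>Integral character sums on cyclic groups\<close>

text \<open>The k-th Fourier coefficient of the indicator of \<open>T\<close>. An integer index
  allows negative frequencies and multiples beyond \<open>m\<close>.\<close>

definition csum :: "nat \<Rightarrow> nat set \<Rightarrow> int \<Rightarrow> complex" where
  "csum m T k = (\<Sum>t\<in>T. zeta m (k * int t))"

lemma cyc_int_csum: "cyc_int m (csum m T k)"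
  unfolding csum_def by (intro cyc_int_sum cyc_int_zeta)

lemma norm_csum_le: "norm (csum m T k) \<le> card T"
  unfolding csum_def using norm_sum[of "\<lambda>t. zeta m (k * int t)" T] by simp

lemma csum_prime_mult:
  assumes "m > 0" "T \<subseteq> {..<m}" "prime q" "q > 2 * m"
    and "csum m T k \<in> \<int>" "csum m T (int q * k) \<in> \<int>"
  shows "csum m T (int q * k) = csum m T k"
proof -
  obtain a b where a: "csum m T k = of_int a" and b: "csum m T (int q * k) = of_int b"
    using assms(5,6) by (auto elim!: Ints_cases)
  obtain z where z: "cyc_int m z" "csum m T k ^ q = csum m T (int q * k) + of_nat q * z"
    using cyc_int_frobenius_sum[OF assms(3), of T m "\<lambda>t. zeta m (k * int t)"] cyc_int_zeta
    by (auto simp: csum_def zeta_power mult_ac)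
  have q: "q > 0" using assms(4) by simp
  \<comment> \<open>The Frobenius cofactor is a quotient of integers and lies in the cyclotomic
    ring, so it is an integer and the congruence modulo \<open>q\<close> holds between
    integers.\<close>
  have "z = of_int (a ^ q - b) / of_nat q"
    using z(2)[unfolded a b] q by (simp add: field_simps)
  then have "z \<in> \<rat>" by (auto intro: Rats_divide)
  then obtain c where "z = of_int c"
    using cyc_int_rational[OF assms(1) z(1)] by (auto elim: Ints_cases)
  then have "of_int (a ^ q) = (of_int (b + int q * c) :: complex)"
    using z(2) by (simp add: a b)
  then have "a ^ q = b + int q * c" by (simp only: of_int_eq_iff)
  then have "b - a = (a ^ q - a) - int q * c" by simp
  then have dvd: "int q dvd b - a"
    using fermat_int[OF assms(3), of a] by (simp only: dvd_diff dvd_triv_left)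
  \<comment> \<open>Both sums are at most \<open>m\<close> in absolute value, so their difference is
    at most \<open>2 * m\<close>, which is smaller than \<open>q\<close>; being divisible by
    \<open>q\<close>, it vanishes.\<close>
  have "card T \<le> m" using assms(2) card_mono[of "{..<m}" T] by simp
  then have "\<bar>a\<bar> \<le> int m" "\<bar>b\<bar> \<le> int m"
    using norm_csum_le[of m T k] norm_csum_le[of m T "int q * k"] by (simp_all add: a b)
  then have "\<bar>b - a\<bar> < int q" using assms(4) by simp
  then have "b = a" using dvd zdvd_imp_le[of "int q" "\<bar>b - a\<bar>"] by force
  then show ?thesis by (simp add: a b)
qed

text \<open>Prime factors of \<open>u\<close> are stripped off one at a time. The frequency
  \<open>k\<close> must stay arbitrary, since the remaining factor acts on a shifted
  frequency.\<close>

lemma csum_mult_large_primes: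
  assumes "m > 0" "T \<subseteq> {..<m}" "\<And>k. csum m T k \<in> \<int>"
  shows "u > 0 \<Longrightarrow> (\<And>p. prime p \<Longrightarrow> p dvd u \<Longrightarrow> p > 2 * m) \<Longrightarrow> csum m T (int u * k) = csum m T k"
proof (induction u arbitrary: k rule: less_induct)
  case (less u)
  show ?case
  proof (cases "u = 1")
    case False
    then obtain p where p: "prime p" "p dvd u" using prime_factor_nat by blast
    then obtain w where w: "u = p * w" by blast
    have "w > 0" "w < u" using less.prems(1) w prime_gt_1_nat[OF p(1)] by auto
    then have "csum m T (int w * (int p * k)) = csum m T (int p * k)"
      using less.prems(2) w by (intro less.IH) auto
    also have "\<dots> = csum m T k"
      using csum_prime_mult[OF assms(1,2) p(1)] less.prems(2)[OF p] assms(3) by blast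
    finally show ?thesis by (simp add: w mult_ac)
  qed simp
qed

text \<open>An elementary substitute for Dirichlet's theorem: add to u the modulus times all small
  primes that do not divide u.\<close>
lemma coprime_residue_large_primes:
  fixes u m B :: nat
  assumes "coprime u m" "m > 0"
  obtains w where "w > 0" "[w = u] (mod m)" "\<And>p. prime p \<Longrightarrow> p dvd w \<Longrightarrow> p > B"
proof -
  define P where "P = \<Prod>{p. prime p \<and> p \<le> B \<and> \<not> p dvd u}"
  have fin: "finite {p. prime p \<and> p \<le> B \<and> \<not> p dvd u}" by simp
  have P0: "P > 0" unfolding P_def by (intro prod_pos) (auto intro: prime_gt_0_nat)
  \<comment> \<open>A small prime divides exactly one of the two summands: either it divides
    \<open>u\<close> and neither \<open>m\<close> nor \<open>P\<close>, or it does not divide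
    \<open>u\<close> and is a factor of \<open>P\<close>.\<close>
  have "\<not> p dvd u + m * P" if p: "prime p" "p \<le> B" for p
  proof (cases "p dvd u")
    case True
    have "\<not> p dvd m"
      using True assms(1) p(1) by (meson coprime_common_divisor_nat not_prime_unit dvd_refl
          coprime_common_divisor prime_def)
    moreover have "\<not> p dvd P"
    proof
      assume "p dvd P"
      then obtain r where r: "prime r" "\<not> r dvd u" "p dvd r"
        using prime_dvd_prod_iff[OF fin p(1), of "\<lambda>x. x"] unfolding P_def by auto
      then have "p = r" using p(1) primes_dvd_imp_eq by blast
      then show False using r(2) True by simp
    qed
    ultimately show ?thesis using True p(1) by (simp add: dvd_add_right_iff prime_dvd_mult_iff)
  next
    case False
    then have "p dvd P" unfolding P_def using p by (intro dvd_prodI[OF fin]) auto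
    then show ?thesis using False by (simp add: dvd_add_left_iff)
  qed
  moreover have "[u + m * P = u] (mod m)" by (simp add: cong_def)
  moreover have "u + m * P > 0" using P0 assms(2) by simp
  ultimately show thesis using that[of "u + m * P"] by (metis not_le_imp_less)
qed

lemma csum_cong:
  assumes "m > 0" "[k = l] (mod int m)"
  shows "csum m T k = csum m T l"
  unfolding csum_def
  by (intro sum.cong refl zeta_cong[OF assms(1)] cong_mult assms(2) cong_refl)

text \<open>Fourier inversion with the frequencies scaled by a unit \<open>c\<close>. Orthogonality
  survives because \<open>c\<close> can be cancelled from a divisibility by
  \<open>m\<close>.\<close>

lemma csum_inversion:
  assumes "m > 0" "T \<subseteq> {..<m}" "coprime c (int m)"
  shows "(\<Sum>k<m. csum m T (c * int k) * zeta m (- (c * int k * x)))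
      = (if nat (x mod int m) \<in> T then of_nat m else 0)"
proof -
  have fin: "finite T" using assms(2) finite_subset by blast
  have "(\<Sum>k<m. csum m T (c * int k) * zeta m (- (c * int k * x)))
      = (\<Sum>k<m. \<Sum>t\<in>T. zeta m (c * (int t - x) * int k))"
    unfolding csum_def sum_distrib_right
    by (intro sum.cong refl) (simp add: zeta_add[symmetric] algebra_simps)
  also have "\<dots> = (\<Sum>t\<in>T. if int m dvd c * (int t - x) then of_nat m else 0)"
    by (subst sum.swap) (simp add: sum_zeta[OF assms(1)])
  also have "\<dots> = (\<Sum>t\<in>T. if t = nat (x mod int m) then of_nat m else 0)"
  proof (intro sum.cong refl)
    fix t assume "t \<in> T"
    then have t: "t < m" using assms(2) by auto
    have "int m dvd c * (int t - x) \<longleftrightarrow> int m dvd int t - x"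
      using assms(3) by (simp add: coprime_dvd_mult_right_iff coprime_commute)
    also have "\<dots> \<longleftrightarrow> int t = x mod int m"
      using t by (simp add: mod_eq_dvd_iff[symmetric])
    also have "\<dots> \<longleftrightarrow> t = nat (x mod int m)"
      using assms(1) by (auto simp: nat_eq_iff)
    finally show "(if int m dvd c * (int t - x) then of_nat m else 0)
        = (if t = nat (x mod int m) then of_nat m else (0 :: complex))" by simp
  qed
  also have "\<dots> = (if nat (x mod int m) \<in> T then of_nat m else 0)"
    using fin by simp
  finally show ?thesis .
qed

text \<open>Inversion at the point \<open>u * x\<close> with unscaled frequencies and inversion at
  \<open>x\<close> with frequencies scaled by \<open>u\<close> have the same exponents; the
  coefficients agree because \<open>u\<close> has only large prime factors.\<close>

lemma mult_invariant_of_integral_csum: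
  assumes "m > 0" "T \<subseteq> {..<m}" "\<And>k. csum m T k \<in> \<int>"
    and "u > 0" "\<And>p. prime p \<Longrightarrow> p dvd u \<Longrightarrow> p > 2 * m"
  shows "(u * x) mod m \<in> T \<longleftrightarrow> x mod m \<in> T"
proof -
  have "coprime u m"
  proof (rule ccontr)
    assume "\<not> coprime u m"
    then have "gcd u m \<noteq> 1" by (simp add: coprime_iff_gcd_eq_1)
    then obtain p where p: "prime p" "p dvd gcd u m" using prime_factor_nat by blast
    then have "p \<le> m" using assms(1) by (auto dest: dvd_imp_le)
    then show False using assms(5)[OF p(1)] p(2) by auto
  qed
  then have cop: "coprime (int u) (int m)" by simp
  have "(if (u * x) mod m \<in> T then of_nat m else 0 :: complex)
      = (\<Sum>k<m. csum m T (1 * int k) * zeta m (- (1 * int k * int (u * x))))"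
    using csum_inversion[OF assms(1,2), of 1 "int (u * x)"] by (simp add: nat_mod_distrib flip: of_nat_mult)
  also have "\<dots> = (\<Sum>k<m. csum m T (int u * int k) * zeta m (- (int u * int k * int x)))"
    using csum_mult_large_primes[OF assms(1-3), of u] assms(4,5)
    by (intro sum.cong refl) (simp add: mult_ac)
  also have "\<dots> = (if x mod m \<in> T then of_nat m else 0)"
    using csum_inversion[OF assms(1,2) cop, of "int x"] by (simp add: nat_mod_distrib)
  finally show ?thesis using assms(1) by (auto split: if_splits)
qed

text \<open>Two residues with the same gcd \<open>d\<close> differ by a factor that is a unit modulo
  \<open>m div d\<close>. That unit is represented by a \<open>u\<close> with only large prime
  factors, and multiplication by \<open>u\<close> preserves \<open>T\<close>.\<close>

lemma gcd_invariant_of_integral_csum: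
  assumes "m > 0" "T \<subseteq> {..<m}" "\<And>k. csum m T k \<in> \<int>"
    and "t \<in> T" "x < m" "gcd x m = gcd t m"
  shows "x \<in> T"
proof -
  define d where "d = gcd t m"
  have "d > 0" using assms(1) by (simp add: d_def)
  obtain t' m' where t': "t = t' * d" "m = m' * d" "coprime t' m'"
    using gcd_coprime_exists[of t m] assms(1) unfolding d_def by auto
  obtain x' m'' where x': "x = x' * d" "m = m'' * d" "coprime x' m''"
    using gcd_coprime_exists[of x m] assms(1,6) unfolding d_def by auto
  have "m'' = m'" using x'(2) t'(2) \<open>d > 0\<close> by simp
  \<comment> \<open>\<open>y\<close> inverts \<open>t'\<close> modulo \<open>m'\<close>, so
    \<open>x' * y\<close> is the unit that carries \<open>t'\<close> to \<open>x'\<close>.\<close>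
  obtain y where y: "[t' * y = 1] (mod m')" using cong_solve_coprime_nat[OF t'(3)] by auto
  have "coprime y m'" using y coprime_iff_invertible_nat[of y m'] by (auto simp: mult.commute)
  then have "coprime (x' * y) m'" using x'(3) \<open>m'' = m'\<close> by simp
  moreover have "m' > 0" using assms(1) t'(2) by (auto intro: Nat.gr0I)
  ultimately obtain u where u: "u > 0" "[u = x' * y] (mod m')"
      "\<And>p. prime p \<Longrightarrow> p dvd u \<Longrightarrow> p > 2 * m"
    using coprime_residue_large_primes[of "x' * y" m' "2 * m"] by blast
  have "[u * t' = x' * y * t'] (mod m')" using u(2) by (rule cong_scalar_right)
  also have "x' * y * t' = x' * (t' * y)" by (simp add: ac_simps)
  also have "[x' * (t' * y) = x' * 1] (mod m')" using y by (rule cong_scalar_left)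
  finally have "u * t' mod m' = x' mod m'" by (simp add: cong_def)
  then have "(u * t' * d) mod (m' * d) = (x' * d) mod (m' * d)"
    by (simp only: mult_mod_left[symmetric])
  then have "(u * t) mod m = x mod m"
    using t'(1,2) x'(1) by (simp only: mult.assoc)
  moreover have "(u * t) mod m \<in> T"
    using mult_invariant_of_integral_csum[OF assms(1-3) u(1,3)] assms(2,4)
    by (metis lessThan_iff mod_less subsetD)
  ultimately show ?thesis using assms(5) by simp
qed

section \<open>The Boolean algebra of a cyclic group\<close>

lemma umul_cyc: "umul n (x, 0) (y, 0) = ((x + y) mod (2 * n), 0)"
  by (simp add: umul_def)

lemma group_cycA:
  assumes "n \<ge> 1"
  shows "group (cycA n)"
proof (rule groupI)
  fix x assume x: "x \<in> carrier (cycA n)"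
  then obtain a where a: "x = (a, 0)" "a < 2 * n" by (auto simp: cycA_def)
  then have "((2 * n - a) mod (2 * n), 0) \<otimes>\<^bsub>cycA n\<^esub> x = \<one>\<^bsub>cycA n\<^esub>"
    by (simp add: cycA_def umul_cyc mod_simps)
  then show "\<exists>y\<in>carrier (cycA n). y \<otimes>\<^bsub>cycA n\<^esub> x = \<one>\<^bsub>cycA n\<^esub>"
    using assms by (intro bexI[of _ "((2 * n - a) mod (2 * n), 0)"]) (auto simp: cycA_def)
qed (use assms in \<open>auto simp: cycA_def umul_cyc mod_simps ac_simps\<close>)

lemma subgroup_cycA_multiples:
  assumes "n \<ge> 1" "d dvd 2 * n"
  shows "subgroup ({x. x < 2 * n \<and> d dvd x} \<times> {0}) (cycA n)"
proof (rule group.subgroupI[OF group_cycA[OF assms(1)]])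
  fix x assume "x \<in> {x. x < 2 * n \<and> d dvd x} \<times> {0 :: nat}"
  then obtain a where a: "x = (a, 0)" "a < 2 * n" "d dvd a" by auto
  have "inv\<^bsub>cycA n\<^esub> x = ((2 * n - a) mod (2 * n), 0)"
    using assms a(1,2)
    by (intro group.inv_equality group_cycA) (auto simp: cycA_def umul_cyc mod_simps)
  then show "inv\<^bsub>cycA n\<^esub> x \<in> {x. x < 2 * n \<and> d dvd x} \<times> {0}"
    using assms a by (auto intro!: dvd_mod dvd_diff_nat)
qed (use assms in \<open>auto simp: cycA_def umul_cyc intro!: dvd_mod exI[of _ 0]\<close>)

lemma boolalg_subset: "X \<in> boolalg G \<Longrightarrow> X \<subseteq> carrier G"
  by (induction rule: boolalg.induct) (auto dest: subgroup.subset)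

lemma boolalg_Diff:
  assumes "X \<in> boolalg G" "Y \<in> boolalg G"
  shows "X - Y \<in> boolalg G"
proof -
  have "X - Y = X \<inter> (carrier G - Y)" using boolalg_subset[OF assms(1)] by auto
  then show ?thesis using assms by (simp add: boolalg.int boolalg.compl)
qed

lemma boolalg_Union:
  assumes "group G" "finite I" "\<And>i. i \<in> I \<Longrightarrow> X i \<in> boolalg G"
  shows "(\<Union>i\<in>I. X i) \<in> boolalg G"
  using assms(2,3)
proof (induction I rule: finite_induct)
  case empty
  have "carrier G \<in> boolalg G" using assms(1) by (intro boolalg.sub group.subgroup_self)
  then show ?case using boolalg_Diff[of "carrier G" G "carrier G"] by simp
qed (auto intro: boolalg.un)

text \<open>The elements generating a given subgroup are what remains of it after its proper
  subgroups are removed; here subgroups are indexed by divisors of \<open>2 * n\<close>, and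
  \<open>D\<close> lists those of the proper ones.\<close>

lemma boolalg_gcd_class:
  assumes "n \<ge> 1"
  shows "{x. x < 2 * n \<and> gcd x (2 * n) = gcd t (2 * n)} \<times> {0} \<in> boolalg (cycA n)"
proof -
  define H where "H d = {x. x < 2 * n \<and> d dvd x} \<times> {0 :: nat}" for d
  define D where "D = {d. d dvd 2 * n \<and> gcd t (2 * n) dvd d \<and> d \<noteq> gcd t (2 * n)}"
  have H: "H d \<in> boolalg (cycA n)" if "d dvd 2 * n" for d
    unfolding H_def using assms that by (intro boolalg.sub subgroup_cycA_multiples)
  have "finite D" using assms by (intro finite_subset[of D "{d. d dvd 2 * n}"]) (auto simp: D_def)
  then have "H (gcd t (2 * n)) - (\<Union>d\<in>D. H d) \<in> boolalg (cycA n)"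
    by (intro boolalg_Diff boolalg_Union H group_cycA assms) (auto simp: D_def)
  moreover have "H (gcd t (2 * n)) - (\<Union>d\<in>D. H d)
      = {x. x < 2 * n \<and> gcd x (2 * n) = gcd t (2 * n)} \<times> {0}"
  proof (intro equalityI subsetI)
    fix z assume z: "z \<in> H (gcd t (2 * n)) - (\<Union>d\<in>D. H d)"
    then obtain x where x: "z = (x, 0)" "x < 2 * n" "gcd t (2 * n) dvd x"
      by (auto simp: H_def)
    then have "gcd x (2 * n) \<notin> D" using z by (auto simp: H_def)
    then have "gcd x (2 * n) = gcd t (2 * n)" using x(3) by (auto simp: D_def)
    then show "z \<in> {x. x < 2 * n \<and> gcd x (2 * n) = gcd t (2 * n)} \<times> {0}" using x by auto
  next
    fix z assume "z \<in> {x. x < 2 * n \<and> gcd x (2 * n) = gcd t (2 * n)} \<times> {0 :: nat}"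
    then obtain x where x: "z = (x, 0)" "x < 2 * n" "gcd x (2 * n) = gcd t (2 * n)" by auto
    have "z \<notin> H d" if "d \<in> D" for d
    proof
      assume "z \<in> H d"
      then have "d dvd gcd x (2 * n)" using that x(1) by (auto simp: H_def D_def)
      then show False using that x(3) by (auto simp: D_def dvd_antisym)
    qed
    moreover have "z \<in> H (gcd t (2 * n))" using x by (simp add: H_def) (metis gcd_dvd1)
    ultimately show "z \<in> H (gcd t (2 * n)) - (\<Union>d\<in>D. H d)" by blast
  qed
  ultimately show ?thesis by simp
qed

lemma boolalg_of_integral_csum:
  assumes "n \<ge> 1" "T \<subseteq> {..<2 * n}" "\<And>k. csum (2 * n) T k \<in> \<int>"
  shows "T \<times> {0} \<in> boolalg (cycA n)"
proof -
  have "T \<times> {0} = (\<Union>t\<in>T. {x. x < 2 * n \<and> gcd x (2 * n) = gcd t (2 * n)} \<times> {0 :: nat})"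
    using gcd_invariant_of_integral_csum[of "2 * n" T, OF _ assms(2,3)] assms(1,2) by auto
  moreover have "finite T" using assms(2) finite_subset by blast
  ultimately show ?thesis
    using boolalg_Union[OF group_cycA[OF assms(1)] _ boolalg_gcd_class[OF assms(1)]]
    by (simp only:)
qed

section \<open>Integral combinations of indicators of subgroups\<close>

inductive subgroup_comb :: "('a, 'b) monoid_scheme \<Rightarrow> ('a \<Rightarrow> int) \<Rightarrow> bool" for G where
  zero: "subgroup_comb G (\<lambda>x. 0)"
| step: "subgroup_comb G f \<Longrightarrow> subgroup H G \<Longrightarrow> subgroup_comb G (\<lambda>x. f x + c * of_bool (x \<in> H))"

lemma subgroup_comb_add:
  assumes "subgroup_comb G f" "subgroup_comb G g"
  shows "subgroup_comb G (\<lambda>x. f x + g x)"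
  using assms(2)
proof (induction rule: subgroup_comb.induct)
  case (step g H c)
  then show ?case using subgroup_comb.step[of G "\<lambda>x. f x + g x" H c] by (simp add: add.assoc)
qed (simp add: assms(1))

lemma subgroup_comb_uminus: "subgroup_comb G f \<Longrightarrow> subgroup_comb G (\<lambda>x. - f x)"
proof (induction rule: subgroup_comb.induct)
  case (step f H c)
  then show ?case using subgroup_comb.step[of G "\<lambda>x. - f x" H "- c"] by simp
qed (simp add: subgroup_comb.zero)

lemma subgroup_comb_diff:
  "subgroup_comb G f \<Longrightarrow> subgroup_comb G g \<Longrightarrow> subgroup_comb G (\<lambda>x. f x - g x)"
  using subgroup_comb_add[of G f "\<lambda>x. - g x"] subgroup_comb_uminus[of G g] by simp

text \<open>A product of two indicators is the indicator of the intersection, and an intersection of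
  subgroups is a subgroup.\<close>

lemma subgroup_comb_mult_subgroup:
  assumes "group G" "subgroup_comb G f" "subgroup K G"
  shows "subgroup_comb G (\<lambda>x. f x * of_bool (x \<in> K))"
  using assms(2)
proof (induction rule: subgroup_comb.induct)
  case (step f H c)
  have "subgroup (H \<inter> K) G"
    using assms(1,3) step.hyps by (intro group.subgroups_Inter_pair)
  then have "subgroup_comb G (\<lambda>x. f x * of_bool (x \<in> K) + c * of_bool (x \<in> H \<inter> K))"
    using step.IH by (intro subgroup_comb.step)
  moreover have "(\<lambda>x. f x * of_bool (x \<in> K) + c * of_bool (x \<in> H \<inter> K))
      = (\<lambda>x. (f x + c * of_bool (x \<in> H)) * of_bool (x \<in> K))"
    by (auto simp: fun_eq_iff)
  ultimately show ?case by simp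
qed (simp add: subgroup_comb.zero)

text \<open>The span of the indicators of subgroups is a ring, since subgroups are closed under
  intersection; multiplying by an arbitrary member keeps the induction going.\<close>
lemma subgroup_comb_mult_boolalg:
  assumes "group G" "X \<in> boolalg G" "subgroup_comb G f"
  shows "subgroup_comb G (\<lambda>x. f x * of_bool (x \<in> X))"
  using assms(2,3)
proof (induction arbitrary: f rule: boolalg.induct)
  case (sub H)
  then show ?case by (intro subgroup_comb_mult_subgroup assms(1))
next
  case (un X Y)
  \<comment> \<open>Inclusion-exclusion for the indicator of a union.\<close>
  have "subgroup_comb G (\<lambda>x. (f x * of_bool (x \<in> X) + f x * of_bool (x \<in> Y))
      - f x * of_bool (x \<in> X) * of_bool (x \<in> Y))"
    using un by (intro subgroup_comb_diff subgroup_comb_add) auto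
  moreover have "(\<lambda>x. (f x * of_bool (x \<in> X) + f x * of_bool (x \<in> Y))
      - f x * of_bool (x \<in> X) * of_bool (x \<in> Y)) = (\<lambda>x. f x * of_bool (x \<in> X \<union> Y))"
    by (auto simp: fun_eq_iff)
  ultimately show ?case by simp
next
  case (int X Y)
  have "subgroup_comb G (\<lambda>x. f x * of_bool (x \<in> X) * of_bool (x \<in> Y))"
    using int by auto
  moreover have "(\<lambda>x. f x * of_bool (x \<in> X) * of_bool (x \<in> Y)) = (\<lambda>x. f x * of_bool (x \<in> X \<inter> Y))"
    by (auto simp: fun_eq_iff)
  ultimately show ?case by simp
next
  case (compl X)
  have "subgroup_comb G (\<lambda>x. f x * of_bool (x \<in> carrier G) - f x * of_bool (x \<in> X))"
    using subgroup_comb_mult_subgroup[OF assms(1) compl.prems group.subgroup_self[OF assms(1)]]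
      compl.IH[OF compl.prems] by (rule subgroup_comb_diff)
  moreover have "(\<lambda>x. f x * of_bool (x \<in> carrier G) - f x * of_bool (x \<in> X))
      = (\<lambda>x. f x * of_bool (x \<in> carrier G - X))"
    using boolalg_subset[OF compl.hyps] by (auto simp: fun_eq_iff)
  ultimately show ?case by simp
qed

text \<open>Either the character is trivial on \<open>H\<close> and the sum counts its elements, or
  translation by some \<open>h\<close> multiplies the sum by a value other than 1 and the sum is
  0.\<close>

lemma sum_zeta_subgroup_Ints:
  assumes "n \<ge> 1" "subgroup H (cycA n)"
  shows "(\<Sum>x\<in>H. zeta (2 * n) (k * int (fst x))) \<in> \<int>" (is "?s \<in> \<int>")
proof -
  have sub: "H \<subseteq> {0..<2 * n} \<times> {0}" using subgroup.subset[OF assms(2)] by (simp add: cycA_def)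
  then have fin: "finite H" by (rule finite_subset) simp
  show ?thesis
  proof (cases "\<forall>x\<in>H. zeta (2 * n) (k * int (fst x)) = 1")
    case True
    then show ?thesis by simp
  next
    case False
    then obtain h where h: "h \<in> H" "zeta (2 * n) (k * int (fst h)) \<noteq> 1" by blast
    interpret group "cycA n" by (rule group_cycA[OF assms(1)])
    have inj: "inj_on (\<lambda>x. h \<otimes>\<^bsub>cycA n\<^esub> x) H"
    proof (rule inj_onI)
      fix x y assume "x \<in> H" "y \<in> H" and eq: "h \<otimes>\<^bsub>cycA n\<^esub> x = h \<otimes>\<^bsub>cycA n\<^esub> y"
      then have "x \<in> carrier (cycA n)" "y \<in> carrier (cycA n)" "h \<in> Units (cycA n)"
        using h(1) subgroup.subset[OF assms(2)] Units_eq by blast+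
      then show "x = y" using eq Units_l_cancel by blast
    qed
    have img: "(\<lambda>x. h \<otimes>\<^bsub>cycA n\<^esub> x) ` H = H"
      using subgroup.m_closed[OF assms(2) h(1)] by (rule endo_inj_surj[OF fin image_subsetI inj])
    have "?s = (\<Sum>x\<in>(\<lambda>x. h \<otimes>\<^bsub>cycA n\<^esub> x) ` H. zeta (2 * n) (k * int (fst x)))"
      by (simp only: img)
    also have "\<dots> = (\<Sum>x\<in>H. zeta (2 * n) (k * int (fst (h \<otimes>\<^bsub>cycA n\<^esub> x))))"
      using inj by (simp add: sum.reindex)
    also have "\<dots> = (\<Sum>x\<in>H. zeta (2 * n) (k * int (fst h)) * zeta (2 * n) (k * int (fst x)))"
    proof (intro sum.cong refl)
      fix x assume "x \<in> H"
      have "zeta (2 * n) (k * int (fst (h \<otimes>\<^bsub>cycA n\<^esub> x)))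
          = zeta (2 * n) (k * int (fst h + fst x))"
        using assms(1)
        by (intro zeta_cong cong_mult cong_refl) (auto simp: cycA_def umul_def cong_def zmod_int)
      then show "zeta (2 * n) (k * int (fst (h \<otimes>\<^bsub>cycA n\<^esub> x)))
          = zeta (2 * n) (k * int (fst h)) * zeta (2 * n) (k * int (fst x))"
        by (simp add: distrib_left zeta_add)
    qed
    also have "\<dots> = zeta (2 * n) (k * int (fst h)) * ?s"
      by (simp add: sum_distrib_left)
    finally have "?s = 0" using h(2) by simp
    then show ?thesis by simp
  qed
qed

lemma sum_zeta_subgroup_comb_Ints:
  assumes "n \<ge> 1" "subgroup_comb (cycA n) f"
  shows "(\<Sum>x\<in>carrier (cycA n). of_int (f x) * zeta (2 * n) (k * int (fst x))) \<in> \<int>"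
  using assms(2)
proof (induction rule: subgroup_comb.induct)
  case (step f H c)
  have H: "H \<subseteq> carrier (cycA n)" by (rule subgroup.subset[OF step.hyps(2)])
  have fin: "finite (carrier (cycA n))" by (simp add: cycA_def)
  have "(\<Sum>x\<in>carrier (cycA n). of_int (c * of_bool (x \<in> H)) * zeta (2 * n) (k * int (fst x)))
      = of_int c * (\<Sum>x\<in>H. zeta (2 * n) (k * int (fst x)))"
    unfolding sum_distrib_left using H fin
    by (intro sum.mono_neutral_cong_right) auto
  then show ?case
    using step.IH sum_zeta_subgroup_Ints[OF assms(1) step.hyps(2), of k]
    by (simp add: distrib_right sum.distrib)
qed simp

lemma integral_csum_of_boolalg:
  assumes "n \<ge> 1" "T \<subseteq> {..<2 * n}" "T \<times> {0} \<in> boolalg (cycA n)"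
  shows "csum (2 * n) T k \<in> \<int>"
proof -
  have grp: "group (cycA n)" by (rule group_cycA[OF assms(1)])
  \<comment> \<open>The indicator of the whole group, in the shape produced by the rule
    \<open>step\<close>, is the starting function to be multiplied by the indicator of
    \<open>T\<close>.\<close>
  have "subgroup_comb (cycA n) (\<lambda>x. 0 + 1 * of_bool (x \<in> carrier (cycA n)))"
    by (intro subgroup_comb.intros group.subgroup_self grp)
  then have "subgroup_comb (cycA n)
      (\<lambda>x. (0 + 1 * of_bool (x \<in> carrier (cycA n))) * of_bool (x \<in> T \<times> {0}))"
    by (rule subgroup_comb_mult_boolalg[OF grp assms(3)])
  from sum_zeta_subgroup_comb_Ints[OF assms(1) this, of k]
  have "(\<Sum>x\<in>carrier (cycA n). of_bool (x \<in> T \<times> {0}) * zeta (2 * n) (k * int (fst x))) \<in> \<int>"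
    by (simp cong: sum.cong)
  also have "(\<Sum>x\<in>carrier (cycA n). of_bool (x \<in> T \<times> {0}) * zeta (2 * n) (k * int (fst x)))
      = (\<Sum>x\<in>T \<times> {0 :: nat}. zeta (2 * n) (k * int (fst x)))"
    using assms(2) by (intro sum.mono_neutral_cong_right) (auto simp: cycA_def)
  also have "\<dots> = csum (2 * n) T k"
    unfolding csum_def by (rule sum.reindex_bij_witness[of _ "\<lambda>t. (t, 0)" fst]) auto
  finally show ?thesis .
qed

section \<open>The spectrum of the Cayley graph\<close>

text \<open>Since the connection set contains full cosets of the subgroup generated by
  \<open>b\<close>, adjacency depends only on the difference of the exponents of \<open>a\<close>,
  and the matrix is a circulant inflated by blocks of size 3.\<close>

lemma cay_adj_entry:
  assumes "n \<ge> 1" "T \<subseteq> {..<2 * n}" "\<And>t. t \<in> T \<Longrightarrow> nat (- int t mod int (2 * n)) \<in> T"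
    and "i < 6 * n" "j < 6 * n"
  shows "cay_adj n (T \<times> {..<3}) $$ (i, j)
      = (if nat ((int (j div 3) - int (i div 3)) mod int (2 * n)) \<in> T then 1 else 0)"
proof -
  let ?m = "2 * n"
  have edge: "(\<exists>s\<in>T \<times> {..<3}. y = umul n s x)
      \<longleftrightarrow> nat ((int (fst y) - int (fst x)) mod int ?m) \<in> T"
    if xy: "fst x < ?m" "fst y < ?m" "snd x < 3" "snd y < 3" for x y
  proof
    assume "\<exists>s\<in>T \<times> {..<3}. y = umul n s x"
    then obtain a e where ae: "a \<in> T" "y = umul n (a, e) x" by auto
    have "[int (fst y) = int a + int (fst x)] (mod int ?m)"
      using ae(2) by (simp add: umul_def cong_def zmod_int)
    then have "[int (fst y) - int (fst x) = int a + int (fst x) - int (fst x)] (mod int ?m)"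
      by (intro cong_diff) auto
    then have "(int (fst y) - int (fst x)) mod int ?m = int a"
      using ae(1) assms(2) by (auto simp: cong_def)
    then show "nat ((int (fst y) - int (fst x)) mod int ?m) \<in> T" using ae(1) by simp
  next
    assume T: "nat ((int (fst y) - int (fst x)) mod int ?m) \<in> T" (is "?a \<in> T")
    have "int ?a = (int (fst y) - int (fst x)) mod int ?m" using assms(1) by simp
    then have "int ((?a + fst x) mod ?m) = int (fst y)"
      using xy(2) by (simp add: zmod_int mod_simps)
    then have 1: "(?a + fst x) mod ?m = fst y" by (simp only: of_nat_eq_iff)
    \<comment> \<open>Doubling is a bijection modulo 3, so the exponent of \<open>b\<close> can be
      matched for either parity of the exponent of \<open>a\<close>.\<close>
    have "\<exists>e<3. ((if even (fst x) then e else 2 * e) + snd x) mod 3 = snd y"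
    proof -
      have "snd x \<in> {0, 1, 2}" "snd y \<in> {0, 1, 2}" using xy by auto
      then have "\<exists>e\<in>{0, 1, 2}. ((if even (fst x) then e else 2 * e) + snd x) mod 3 = snd y"
        by (cases "even (fst x)") auto
      then show ?thesis by (auto intro: exI[of _ 0] exI[of _ 1] exI[of _ 2])
    qed
    then obtain e where "e < 3" "((if even (fst x) then e else 2 * e) + snd x) mod 3 = snd y"
      by blast
    then have "y = umul n (?a, e) x"
      using 1 by (simp only: umul_def prod_eq_iff fst_conv snd_conv)
    then show "\<exists>s\<in>T \<times> {..<3}. y = umul n s x" using T \<open>e < 3\<close> by (intro bexI[of _ "(?a, e)"]) auto
  qed
  \<comment> \<open>Closure of \<open>T\<close> under negation makes the two disjuncts in the
    definition of adjacency equivalent.\<close>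
  have sym: "nat (- l mod int ?m) \<in> T" if "nat (l mod int ?m) \<in> T" for l
    using assms(3)[OF that] assms(1) by (simp add: mod_simps)
  have "nat ((int (i div 3) - int (j div 3)) mod int ?m) \<in> T
      \<longleftrightarrow> nat ((int (j div 3) - int (i div 3)) mod int ?m) \<in> T"
    using sym[of "int (i div 3) - int (j div 3)"] sym[of "int (j div 3) - int (i div 3)"] by auto
  then show ?thesis
    using assms(4,5) edge[of "uelt i" "uelt j"] edge[of "uelt j" "uelt i"]
    by (simp add: cay_adj_def uelt_def bex_disj_distrib less_mult_imp_div_less)
qed

lemma sum_div3:
  fixes g :: "nat \<Rightarrow> 'a :: comm_ring_1"
  shows "(\<Sum>i<3 * m. g (i div 3)) = 3 * (\<Sum>x<m. g x)"
proof (induction m)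
  case (Suc m)
  have div: "3 * m div 3 = m" "(3 * m + 1) div 3 = m" "(3 * m + 2) div 3 = m" by simp_all
  have "{..<3 * Suc m} = {..<Suc (Suc (Suc (3 * m)))}" by simp
  then have "(\<Sum>i<3 * Suc m. g (i div 3))
      = (\<Sum>i<3 * m. g (i div 3)) + g (3 * m div 3) + g ((3 * m + 1) div 3) + g ((3 * m + 2) div 3)"
    by (simp only: sum.lessThan_Suc) simp
  also have "\<dots> = 3 * (\<Sum>x<m. g x) + (g m + g m + g m)"
    by (simp only: Suc.IH div add.assoc)
  also have "\<dots> = 3 * (\<Sum>x<Suc m. g x)"
    by (simp add: algebra_simps)
  finally show ?case .
qed simp

lemma sum_zeta_div3:
  assumes "m > 0"
  shows "(\<Sum>i<3 * m. zeta m (k * int (i div 3))) = (if int m dvd k then 3 * of_nat m else 0)"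
  using sum_div3[of "\<lambda>x. zeta m (k * int x)" m] by (simp add: sum_zeta[OF assms])

text \<open>The adjacency matrix, diagonalised by the characters of the cyclic subgroup inflated along
  the index map \<open>i \<mapsto> i div 3\<close>.\<close>
lemma cay_adj_mult_vec:
  assumes "n \<ge> 1" "T \<subseteq> {..<2 * n}" "\<And>t. t \<in> T \<Longrightarrow> nat (- int t mod int (2 * n)) \<in> T"
    and "i < 6 * n" "dim_vec v = 6 * n"
  shows "of_nat (2 * n) * (cay_adj n (T \<times> {..<3}) *\<^sub>v v) $ i
    = (\<Sum>k<2 * n. csum (2 * n) T (int k) * zeta (2 * n) (int k * int (i div 3))
        * (\<Sum>j<6 * n. v $ j * zeta (2 * n) (- (int k * int (j div 3)))))"
proof -
  let ?m = "2 * n"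
  have "?m > 0" using assms(1) by simp
  note inv = csum_inversion[OF this assms(2), of 1]
  \<comment> \<open>Inversion at the difference of the two exponents; the factor
    \<open>2 * n\<close> clears its denominator.\<close>
  have entry: "of_nat ?m * cay_adj n (T \<times> {..<3}) $$ (i, j) = (\<Sum>k<?m. csum ?m T (int k)
      * zeta ?m (int k * int (i div 3)) * zeta ?m (- (int k * int (j div 3))))" if "j < 6 * n" for j
    using inv[of "int (j div 3) - int (i div 3)"] cay_adj_entry[OF assms(1-4) that]
    by (simp add: zeta_add[symmetric] algebra_simps)
  have "of_nat ?m * (cay_adj n (T \<times> {..<3}) *\<^sub>v v) $ i
      = (\<Sum>j<6 * n. of_nat ?m * cay_adj n (T \<times> {..<3}) $$ (i, j) * v $ j)"
    using assms(4,5)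
    by (simp add: scalar_prod_def cay_adj_def sum_distrib_left atLeast0LessThan mult.assoc)
  also have "\<dots> = (\<Sum>j<6 * n. \<Sum>k<?m. csum ?m T (int k) * zeta ?m (int k * int (i div 3))
      * (v $ j * zeta ?m (- (int k * int (j div 3)))))"
    by (intro sum.cong refl, subst entry) (simp_all add: sum_distrib_left sum_distrib_right mult_ac)
  also have "\<dots> = (\<Sum>k<?m. csum ?m T (int k) * zeta ?m (int k * int (i div 3))
        * (\<Sum>j<6 * n. v $ j * zeta ?m (- (int k * int (j div 3)))))"
    by (subst sum.swap) (simp add: sum_distrib_left)
  finally show ?thesis .
qed

lemma dvd_int_diff_lessThan:
  assumes "k < m" "l < m"
  shows "int m dvd int k - int l \<longleftrightarrow> k = l"
  using assms by (simp add: mod_eq_dvd_iff[symmetric])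

text \<open>Inflated characters are eigenvectors with eigenvalue \<open>3 * csum\<close>, the 3
  being the block size. Conversely, an eigenvector with a nonzero Fourier coefficient has one of
  these eigenvalues, and any other eigenvector has eigenvalue 0.\<close>

lemma integral_cay_adj_iff:
  assumes "n \<ge> 1" "T \<subseteq> {..<2 * n}" "\<And>t. t \<in> T \<Longrightarrow> nat (- int t mod int (2 * n)) \<in> T"
  shows "integral_graph (cay_adj n (T \<times> {..<3})) \<longleftrightarrow> (\<forall>k. csum (2 * n) T k \<in> \<int>)"
proof
  let ?m = "2 * n" and ?A = "cay_adj n (T \<times> {..<3})"
  have m: "?m > 0" using assms(1) by simp
  have dim: "?A \<in> carrier_mat (6 * n) (6 * n)" by (simp add: cay_adj_def)
  have six: "6 * n = 3 * ?m" by simp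
  {
    assume int: "integral_graph ?A"
    have "csum ?m T (int l) \<in> \<int>" if l: "l < ?m" for l
    proof -
      define v where "v = vec (6 * n) (\<lambda>j. zeta ?m (int l * int (j div 3)))"
      have F: "(\<Sum>j<6 * n. v $ j * zeta ?m (- (int k * int (j div 3))))
          = (if k = l then 3 * of_nat ?m else 0)" if "k < ?m" for k
      proof -
        have "(\<Sum>j<6 * n. v $ j * zeta ?m (- (int k * int (j div 3))))
            = (\<Sum>j<3 * ?m. zeta ?m ((int l - int k) * int (j div 3)))"
          unfolding six
          by (intro sum.cong refl) (simp add: v_def zeta_add[symmetric] algebra_simps)
        then show ?thesis
          using sum_zeta_div3[OF m, of "int l - int k"] dvd_int_diff_lessThan[OF l that] by auto
      qed
      have "?A *\<^sub>v v = (3 * csum ?m T (int l)) \<cdot>\<^sub>v v"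
      proof (rule eq_vecI)
        fix i assume "i < dim_vec ((3 * csum ?m T (int l)) \<cdot>\<^sub>v v)"
        then have i: "i < 6 * n" by (simp add: v_def)
        have "of_nat ?m * (?A *\<^sub>v v) $ i = (\<Sum>k<?m. csum ?m T (int k)
            * zeta ?m (int k * int (i div 3)) * (if k = l then 3 * of_nat ?m else 0))"
          using F cay_adj_mult_vec[OF assms i, of v] by (simp add: v_def)
        also have "\<dots> = of_nat ?m * ((3 * csum ?m T (int l)) \<cdot>\<^sub>v v) $ i"
          using l i by (simp add: v_def if_distrib cong: if_cong)
        finally show "(?A *\<^sub>v v) $ i = ((3 * csum ?m T (int l)) \<cdot>\<^sub>v v) $ i"
          using m by (simp only: mult_cancel_left of_nat_eq_0_iff) auto
      qed (simp add: v_def cay_adj_def)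
      moreover have "v $ 0 \<noteq> (0\<^sub>v (6 * n) :: complex vec) $ 0"
        using assms(1) by (simp add: v_def)
      then have "v \<noteq> 0\<^sub>v (6 * n)" by metis
      ultimately have "eigenvalue ?A (3 * csum ?m T (int l))"
        unfolding eigenvalue_def eigenvector_def using dim
        by (intro exI[of _ v]) (auto simp: v_def)
      then obtain c where "3 * csum ?m T (int l) = of_int c"
        using int unfolding integral_graph_def by (auto elim: Ints_cases)
      \<comment> \<open>Integrality of the eigenvalue only makes the character sum rational;
        membership in the cyclotomic ring removes the denominator 3.\<close>
      then have "csum ?m T (int l) = of_int c / of_int 3" by (simp add: field_simps)
      then have "csum ?m T (int l) \<in> \<rat>" by (simp only: Rats_divide Rats_of_int)
      then show ?thesis using cyc_int_rational[OF m cyc_int_csum] by blast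
    qed
    moreover have "csum ?m T k = csum ?m T (int (nat (k mod int ?m)))" for k
      using m by (intro csum_cong) (simp_all add: cong_def)
    moreover have "nat (k mod int ?m) < ?m" for k
      using m by (simp add: nat_less_iff)
    ultimately show "\<forall>k. csum ?m T k \<in> \<int>" by metis
  }
  {
    assume int: "\<forall>k. csum ?m T k \<in> \<int>"
    show "integral_graph ?A" unfolding integral_graph_def
    proof (intro allI impI)
      fix ev assume "eigenvalue ?A ev"
      then obtain v where "eigenvector ?A v ev" unfolding eigenvalue_def ..
      then have v: "dim_vec v = 6 * n" "v \<noteq> 0\<^sub>v (6 * n)" "?A *\<^sub>v v = ev \<cdot>\<^sub>v v"
        unfolding eigenvector_def carrier_matD(1)[OF dim] by auto
      \<comment> \<open>\<open>F k\<close> is the pairing of \<open>v\<close> with the inflated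
        character of frequency \<open>k\<close>.\<close>
      define F where "F k = (\<Sum>j<6 * n. v $ j * zeta ?m (- (int k * int (j div 3))))" for k
      have Av: "of_nat ?m * (ev * v $ i)
          = (\<Sum>k<?m. csum ?m T (int k) * zeta ?m (int k * int (i div 3)) * F k)"
        if "i < 6 * n" for i
        using cay_adj_mult_vec[OF assms that v(1)] v(1,3) that by (simp add: F_def)
      have evF: "ev * F l = 3 * csum ?m T (int l) * F l" if l: "l < ?m" for l
      proof -
        have "of_nat ?m * (ev * F l)
            = (\<Sum>i<6 * n. of_nat ?m * (ev * v $ i) * zeta ?m (- (int l * int (i div 3))))"
          by (simp add: F_def sum_distrib_left mult_ac)
        also have "\<dots> = (\<Sum>i<6 * n. \<Sum>k<?m. csum ?m T (int k) * F k
            * zeta ?m ((int k - int l) * int (i div 3)))"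
          by (intro sum.cong refl, subst Av)
            (simp_all add: sum_distrib_left sum_distrib_right left_diff_distrib zeta_add[of _ _ "- _", simplified] mult_ac)
        also have "\<dots> = (\<Sum>k<?m. csum ?m T (int k) * F k
            * (\<Sum>i<3 * ?m. zeta ?m ((int k - int l) * int (i div 3))))"
          unfolding six by (subst sum.swap) (simp add: sum_distrib_left)
        also have "\<dots> = (\<Sum>k<?m. if k = l then csum ?m T (int k) * F k * (3 * of_nat ?m) else 0)"
        proof (intro sum.cong refl)
          fix k assume "k \<in> {..<?m}"
          then have "k < ?m" by simp
          then show "csum ?m T (int k) * F k * (\<Sum>i<3 * ?m. zeta ?m ((int k - int l) * int (i div 3)))
              = (if k = l then csum ?m T (int k) * F k * (3 * of_nat ?m) else 0)"
            by (cases "k = l")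
              (simp_all only: sum_zeta_div3[OF m] dvd_int_diff_lessThan[OF _ l] if_True if_False mult_zero_right simp_thms)
        qed
        also have "\<dots> = of_nat ?m * (3 * csum ?m T (int l) * F l)"
          using l by simp
        finally show ?thesis
          using m by (simp only: mult_cancel_left of_nat_eq_0_iff) auto
      qed
      show "ev \<in> \<int>"
      proof (cases "\<exists>l<?m. F l \<noteq> 0")
        case True
        then obtain l where "l < ?m" "F l \<noteq> 0" by blast
        then have "ev = 3 * csum ?m T (int l)" using evF[of l] by simp
        then show ?thesis using int by simp
      next
        case False
        obtain i where "i < 6 * n" "v $ i \<noteq> 0" using v(1,2) by (metis eq_vecI index_zero_vec)
        then have "ev = 0" using Av[of i] False m by simp
        then show ?thesis by simp
      qed
    qed
  }
qed

section \<open>The connection set in the group and the degree-two characters\<close>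

lemma inv_U_cyc:
  assumes "n \<ge> 1" "t < 2 * n"
  shows "inv\<^bsub>U n\<^esub> (t, 0) = (nat (- int t mod int (2 * n)), 0)"
proof -
  let ?s = "nat (- int t mod int (2 * n))"
  have s: "?s < 2 * n" "int ?s = - int t mod int (2 * n)"
    using assms(1) by (simp_all add: nat_less_iff)
  have "int ((t + ?s) mod (2 * n)) = 0" using s(2) by (simp add: zmod_int mod_simps)
  then have ts: "(t + ?s) mod (2 * n) = 0" by simp
  show ?thesis
    unfolding m_inv_def
  proof (rule the_equality)
    show "(?s, 0) \<in> carrier (U n) \<and> (t, 0) \<otimes>\<^bsub>U n\<^esub> (?s, 0) = \<one>\<^bsub>U n\<^esub>
        \<and> (?s, 0) \<otimes>\<^bsub>U n\<^esub> (t, 0) = \<one>\<^bsub>U n\<^esub>"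
      using s(1) ts by (simp add: U_def umul_def add.commute)
  next
    fix y assume "y \<in> carrier (U n) \<and> (t, 0) \<otimes>\<^bsub>U n\<^esub> y = \<one>\<^bsub>U n\<^esub> \<and> y \<otimes>\<^bsub>U n\<^esub> (t, 0) = \<one>\<^bsub>U n\<^esub>"
    then have y: "fst y < 2 * n" "snd y < 3" "(t + fst y) mod (2 * n) = 0" "snd y mod 3 = 0"
      by (auto simp: U_def umul_def split: if_splits)
    have "[t + fst y = t + ?s] (mod 2 * n)" using y(3) ts by (simp add: cong_def)
    then have "[fst y = ?s] (mod 2 * n)" by (simp only: cong_add_lcancel_nat)
    then have "fst y = ?s" using y(1) s(1) by (rule cong_less_modulus_unique_nat)
    then show "y = (?s, 0)" using y(2,4) by (simp add: prod_eq_iff)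
  qed
qed

text \<open>On a coset of the subgroup generated by \<open>b\<close> the character takes the values
  \<open>2 * w\<close>, \<open>- w\<close>, \<open>- w\<close>, or is zero throughout, so already
  the inner sum vanishes.\<close>

lemma charsq_psi_eq_0: "charsq n (psi n k) (T \<times> {..<3}) = 0"
proof -
  have "(\<Sum>x2\<in>T \<times> {..<3}. psi n k (umul n x1 x2)) = 0" for x1
  proof -
    have "(\<Sum>f<3. psi n k (umul n x1 (t, f))) = 0" for t
    proof -
      \<comment> \<open>The exponent of \<open>b\<close> in the first factor after it is moved past
        the power \<open>t\<close> of \<open>a\<close>.\<close>
      define c where "c = (if even t then snd x1 else 2 * snd x1)"
      have "c mod 3 \<in> {0, 1, 2}" "{..<3} = {0, 1, 2 :: nat}" by auto
      then have "(\<Sum>f<3. if (c mod 3 + f) mod 3 = 0 then 2 * w else - w) = (0 :: complex)" for w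
        by (elim insertE emptyE) simp_all
      then have "(\<Sum>f<3. if (c + f) mod 3 = 0 then 2 * w else - w) = (0 :: complex)" for w
        by (simp only: mod_add_left_eq)
      then show ?thesis
        by (cases "even ((fst x1 + t) mod (2 * n))")
          (simp_all only: psi_def umul_def c_def[symmetric] fst_conv snd_conv if_True if_False sum.neutral_const)
    qed
    then show ?thesis by (simp add: sum.cartesian_product')
  qed
  then show ?thesis unfolding charsq_def by simp
qed

theorem theorem4p7:
  fixes n :: nat and R H :: "nat set"
  defines "S1 \<equiv> (\<Union>r\<in>R. {apow n (2 * int r) 0, apow n (2 * int r) 1, apow n (- 2 * int r) 2})"
      and "S2 \<equiv> (\<Union>h\<in>H. {apow n (2 * int h + 1) 0, apow n (2 * int h + 1) 1, apow n (2 * int h + 1) 2})"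
      and "SR \<equiv> (\<lambda>r. apow n (2 * int r) 0) ` R"
      and "SH \<equiv> (\<lambda>h. apow n (2 * int h + 1) 0) ` H"
  assumes "n \<ge> 1"
      and "R \<subseteq> {0..<n}" and "H \<subseteq> {0..<n}"
      and "\<one>\<^bsub>U n\<^esub> \<notin> S1 \<union> S2"
      and "(\<lambda>x. inv\<^bsub>U n\<^esub> x) ` (S1 \<union> S2) = S1 \<union> S2"
  shows "integral_graph (cay_adj n (S1 \<union> S2)) \<longleftrightarrow>
           (SR \<union> SH \<in> boolalg (cycA n) \<and>
            (\<forall>k<n. \<exists>m::int. 2 * charsq n (psi n k) S2 = of_int (m ^ 2)))"
proof -
  define E where "E = (\<lambda>r. 2 * r) ` R"
  define D where "D = (\<lambda>h. 2 * h + 1) ` H"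
  have E: "E \<subseteq> {..<2 * n}" "\<And>x. x \<in> E \<Longrightarrow> even x" using assms(6) by (auto simp: E_def)
  have D: "D \<subseteq> {..<2 * n}" "\<And>x. x \<in> D \<Longrightarrow> odd x" using assms(7) by (force simp: D_def)+
  have apow_even: "apow n (2 * int r) e = (2 * r, e mod 3)" if "r \<in> R" for r e
    using assms(6) that by (auto simp: apow_def)
  have apow_odd: "apow n (2 * int h + 1) e = (2 * h + 1, e mod 3)" if "h \<in> H" for h e
  proof -
    have "2 * h + 1 < 2 * n" using assms(7) that by auto
    then have "(2 * int h + 1) mod int (2 * n) = int (2 * h + 1)"
      by (subst mod_pos_pos_trivial) auto
    then show ?thesis by (simp add: apow_def)
  qed
  have SR: "SR = E \<times> {0}" by (auto simp: SR_def E_def apow_even)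
  have SH: "SH = D \<times> {0}" by (auto simp: SH_def D_def apow_odd)
  have three: "{..<3} = {0, 1, 2 :: nat}" by auto
  have S2: "S2 = D \<times> {..<3}"
    by (auto simp: S2_def D_def apow_odd three)
  \<comment> \<open>Negation of exponents modulo \<open>2 * n\<close>; it describes the third layer
    of \<open>S1\<close>, whose exponents carry a minus sign.\<close>
  define N where "N t = nat (- int t mod int (2 * n))" for t
  have apow_neg: "apow n (- (2 * int r)) e = (N (2 * r), e mod 3)" for r e
    by (simp add: apow_def N_def)
  have S1: "S1 = E \<times> {0, 1} \<union> N ` E \<times> {2}"
    by (auto simp: S1_def E_def apow_even apow_neg)
  have memS: "(t, 0) \<in> S1 \<union> S2 \<longleftrightarrow> t \<in> E \<union> D" for t
    by (auto simp: S1 S2)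
  have N_mem: "N t \<in> E \<union> D" if "t \<in> E \<union> D" for t
  proof -
    have "t < 2 * n" using that E(1) D(1) by auto
    then have "(N t, 0) \<in> S1 \<union> S2"
      using inv_U_cyc[OF assms(5)] assms(9) memS[of t] that unfolding N_def by (metis image_eqI)
    then show ?thesis by (simp only: memS)
  qed
  \<comment> \<open>The modulus is even, so negation keeps parity and closure of the whole set under
    inversion restricts to the even exponents \<open>E\<close>.\<close>
  have N_parity: "even (N t) \<longleftrightarrow> even t" for t
  proof -
    have "int (N t) = - int t mod int (2 * n)" using assms(5) by (simp add: N_def)
    then have "even (int (N t)) \<longleftrightarrow> even (- int t)" by (simp add: dvd_mod_iff)
    then show ?thesis by simp
  qed
  have N_E: "N t \<in> E" if "t \<in> E" for t
    using N_mem[of t] N_parity[of t] E(2) D(2) that by blast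
  have N_N: "N (N t) = t" if "t \<in> E" for t
  proof -
    have "int (N t) = - int t mod int (2 * n)" using assms(5) by (simp add: N_def)
    then show ?thesis using that E(1) by (auto simp: N_def[of "N t"] mod_simps)
  qed
  \<comment> \<open>Hence all three layers of \<open>S1\<close> have the same exponents, and the
    connection set is a full product.\<close>
  have "N ` E = E"
  proof (intro equalityI image_subsetI N_E subsetI)
    fix x assume "x \<in> E"
    then show "x \<in> N ` E" using image_eqI[of x N "N x" E] N_E N_N by simp
  qed
  then have S: "S1 \<union> S2 = (E \<union> D) \<times> {..<3}" by (auto simp: S1 S2 three)
  have EO: "E \<union> D \<subseteq> {..<2 * n}" using E(1) D(1) by simp
  have "integral_graph (cay_adj n (S1 \<union> S2)) \<longleftrightarrow> (\<forall>k. csum (2 * n) (E \<union> D) k \<in> \<int>)"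
    unfolding S using assms(5) EO N_mem unfolding N_def by (rule integral_cay_adj_iff)
  also have "\<dots> \<longleftrightarrow> SR \<union> SH \<in> boolalg (cycA n)"
    using boolalg_of_integral_csum[OF assms(5) EO] integral_csum_of_boolalg[OF assms(5) EO]
    unfolding SR SH Sigma_Un_distrib1[symmetric] by blast
  \<comment> \<open>Condition (2) asks that 0 be a square, with witness 0.\<close>
  finally show ?thesis
    unfolding S2 charsq_psi_eq_0 by (auto intro: exI[of _ 0])
qed

end
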